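(* Let $H$ be a real Hilbert space, let $L>0$, and let $M\colon H\to H$ be a monotone and $L$-Lipschitz continuous operator with $\operatorname{zer} M:=\{x\in H\mid M(x)=0\}\neq\emptyset$. Let $\theta>0$, $x^0\in H$, and let $(x^k)_{k\ge0}$, $(y^{k+1})_{k\ge0}$ be generated by the Extra-Gradient method, i.e., for all $k\ge0$, $$\begin{cases} y^{k+1}=x^k-\theta M(x^k),\\ x^{k+1}=x^k-\theta M(y^{k+1}).\end{cases}$$ If $\theta\in\big(0,\frac1L\big]$, then $\|M(x^{k+1})\|\le\|M(x^k)\|$ for all $k\ge0$. If $\theta\in\big(0,\frac1L\big)$, then $\|M(x^k)\|=o(k^{-1/2})$ as $k\to+\infty$.
   Context: Superscripts $k$ on $x^k,y^k$ are indices, not powers. $M$ monotone means $\langle M(x)-M(x'),x-x'\rangle\ge0$ for all $x,x'\in H$. $L$-Lipschitz means $\|M(x)-M(x')\|\le L\|x-x'\|$ for all $x,x'\in H$. *)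

theory Defs
  imports "HOL-Analysis.Analysis" "HOL-Library.Landau_Symbols"
begin

definition monotone_operator :: "('a::real_inner \<Rightarrow> 'a) \<Rightarrow> bool"
  where "monotone_operator M \<longleftrightarrow> (\<forall>x x'. (M x - M x') \<bullet> (x - x') \<ge> 0)"

definition zer :: "('a::real_inner \<Rightarrow> 'a) \<Rightarrow> 'a set"
  where "zer M = {x. M x = 0}"

(* Only the values y (Suc k) are constrained: the sequence of the y's starts at index 1. *)
definition extra_gradient ::
    "('a::real_inner \<Rightarrow> 'a) \<Rightarrow> real \<Rightarrow> (nat \<Rightarrow> 'a) \<Rightarrow> (nat \<Rightarrow> 'a) \<Rightarrow> bool"
  where "extra_gradient M \<theta> x y \<longleftrightarrow>
    (\<forall>k. y (Suc k) = x k - \<theta> *\<^sub>R M (x k) \<and>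
         x (Suc k) = x k - \<theta> *\<^sub>R M (y (Suc k)))"

end

theory Submission
  imports Defs
begin

text \<open>
  Write \<open>a\<close>, \<open>b\<close>, \<open>c\<close> for the values of \<open>M\<close> at \<open>x\<^sup>k\<close>, \<open>y\<^sup>k\<^sup>+\<^sup>1\<close>, \<open>x\<^sup>k\<^sup>+\<^sup>1\<close>. Both claims come from
  adding one monotonicity inequality to one squared Lipschitz bound.

  For the first claim (lemma \<open>extra_gradient_step_residual\<close>), the full step is
  \<open>x\<^sup>k\<^sup>+\<^sup>1 - x\<^sup>k = - \<theta> b\<close>, so monotonicity between the two iterates reads \<open>\<langle>c - a, b\<rangle> \<le> 0\<close>, while
  \<open>x\<^sup>k\<^sup>+\<^sup>1 - y\<^sup>k\<^sup>+\<^sup>1 = \<theta> (a - b)\<close> turns the Lipschitz bound into \<open>\<parallel>c - b\<parallel> \<le> \<parallel>a - b\<parallel>\<close> as soon as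
  \<open>\<theta> L \<le> 1\<close>. Expanding the squares cancels \<open>\<parallel>b\<parallel>\<^sup>2\<close> and leaves \<open>\<parallel>c\<parallel>\<^sup>2 \<le> \<parallel>a\<parallel>\<^sup>2\<close>.

  For the second claim, fix a zero \<open>z\<close>. Monotonicity between \<open>y\<^sup>k\<^sup>+\<^sup>1\<close> and \<open>z\<close> shows that each step
  decreases \<open>\<parallel>x\<^sup>k - z\<parallel>\<^sup>2\<close> by at least \<open>\<theta>\<^sup>2 (1 - (\<theta> L)\<^sup>2) \<parallel>a\<parallel>\<^sup>2\<close> (lemma
  \<open>extra_gradient_step_distance\<close>). When \<open>\<theta> L < 1\<close> the factor is positive, and telescoping makes
  the sequence \<open>\<parallel>M x\<^sup>k\<parallel>\<^sup>2\<close> summable. By the first claim it is also nonincreasing, and a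
  nonincreasing summable sequence is \<open>o(1/k)\<close> (lemma \<open>decseq_summable_times_index_tendsto_0\<close>).
\<close>

section \<open>Nonincreasing summable sequences\<close>

text \<open>
  Olivier's theorem. By monotonicity the terms with indices in the upper half of \<open>{..<n}\<close>
  are all at least \<open>f n\<close>, so \<open>n * f n\<close> is at most twice their sum; that sum is a difference of two
  partial sums with the same limit.
\<close>
lemma decseq_summable_times_index_tendsto_0:
  fixes f :: "nat \<Rightarrow> real"
  assumes dec: "decseq f" and summ: "summable f" and nonneg: "\<And>n. 0 \<le> f n"
  shows "(\<lambda>n. real n * f n) \<longlonglongrightarrow> 0"
proof -
  define S where "S n = sum f {..<n}" for n
  have S: "S \<longlonglongrightarrow> suminf f"
    unfolding S_def by (rule summable_LIMSEQ[OF summ])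
  have "filterlim (\<lambda>n::nat. n div 2) at_top sequentially"
    by (rule filterlim_at_top_div_const_nat) simp
  then have "(\<lambda>n. S (n div 2)) \<longlonglongrightarrow> suminf f"
    by (rule filterlim_compose[OF S])
  then have lim: "(\<lambda>n. 2 * (S n - S (n div 2))) \<longlonglongrightarrow> 0"
    using tendsto_mult_left[OF tendsto_diff[OF S], of _ "suminf f" 2] by simp
  have le: "real n * f n \<le> 2 * (S n - S (n div 2))" for n
  proof -
    have "real n * f n \<le> 2 * (real (n - n div 2) * f n)"
    proof -
      have "real n \<le> 2 * real (n - n div 2)" by linarith
      from mult_right_mono[OF this nonneg[of n]] show ?thesis by (simp only: mult.assoc)
    qed
    also have "real (n - n div 2) * f n = (\<Sum>i\<in>{n div 2..<n}. f n)" by simp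
    also have "\<dots> \<le> sum f {n div 2..<n}"
      by (intro sum_mono) (use dec in \<open>auto simp: decseq_def\<close>)
    also have "\<dots> = S n - S (n div 2)"
      unfolding S_def lessThan_atLeast0 by (simp add: sum_diff_nat_ivl)
    finally show ?thesis by simp
  qed
  show ?thesis
    by (rule tendsto_sandwich[OF _ _ tendsto_const lim]) (use le nonneg in auto)
qed

section \<open>A single extra-gradient step\<close>

lemma extra_gradient_step_residual:
  fixes M :: "'a::real_inner \<Rightarrow> 'a"
  assumes mono: "monotone_operator M" and lip: "L-lipschitz_on UNIV M"
    and \<theta>: "0 < \<theta>" "\<theta> * L \<le> 1"
    and y: "y = u - \<theta> *\<^sub>R M u" and v: "v = u - \<theta> *\<^sub>R M y"
  shows "norm (M v) \<le> norm (M u)"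
proof -
  have "0 \<le> (M v - M u) \<bullet> (v - u)"
    using mono by (simp add: monotone_operator_def)
  then have "0 \<le> - (\<theta> * ((M v - M u) \<bullet> M y))"
    by (simp add: v)
  then have mono_uv: "(M v - M u) \<bullet> M y \<le> 0"
    using \<theta>(1) by (simp add: mult_le_0_iff)
  have vy: "v - y = \<theta> *\<^sub>R (M u - M y)"
    by (simp add: v y scaleR_diff_right)
  have "norm (M v - M y) \<le> L * norm (v - y)"
    using lipschitz_onD[OF lip, of v y] by (simp add: dist_norm)
  also have "\<dots> = (\<theta> * L) * norm (M u - M y)"
    using \<theta>(1) by (simp add: vy)
  also have "\<dots> \<le> norm (M u - M y)"
    using mult_right_mono[OF \<theta>(2) norm_ge_zero] by simp
  finally have "(norm (M v - M y))\<^sup>2 \<le> (norm (M u - M y))\<^sup>2"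
    by (simp add: power_mono)
  moreover have "(norm (M v - M y))\<^sup>2 - (norm (M u - M y))\<^sup>2
      = (norm (M v))\<^sup>2 - (norm (M u))\<^sup>2 - 2 * ((M v - M u) \<bullet> M y)"
    by (simp add: power2_norm_eq_inner inner_diff_left inner_diff_right inner_commute)
  ultimately have "(norm (M v))\<^sup>2 \<le> (norm (M u))\<^sup>2"
    using mono_uv by linarith
  then show ?thesis
    by (rule power2_le_imp_le) simp
qed

text \<open>
  The direction \<open>M y\<close> makes a nonnegative product with \<open>y - z\<close>, so replacing \<open>u - z\<close> by
  \<open>u - y = \<theta> M u\<close> in the cross term only weakens the estimate; completing the square leaves
  \<open>\<theta>\<^sup>2 (\<parallel>M y - M u\<parallel>\<^sup>2 - \<parallel>M u\<parallel>\<^sup>2)\<close>, where the first term is controlled by the Lipschitz constant.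
\<close>
lemma extra_gradient_step_distance:
  fixes M :: "'a::real_inner \<Rightarrow> 'a"
  assumes mono: "monotone_operator M" and lip: "L-lipschitz_on UNIV M"
    and \<theta>: "0 < \<theta>" and z: "z \<in> zer M"
    and y: "y = u - \<theta> *\<^sub>R M u" and v: "v = u - \<theta> *\<^sub>R M y"
  shows "(norm (v - z))\<^sup>2 + \<theta>\<^sup>2 * (1 - (\<theta> * L)\<^sup>2) * (norm (M u))\<^sup>2 \<le> (norm (u - z))\<^sup>2"
proof -
  have "0 \<le> (M y - M z) \<bullet> (y - z)"
    using mono by (simp add: monotone_operator_def)
  then have "0 \<le> M y \<bullet> (u - z - \<theta> *\<^sub>R M u)"
    using z by (simp add: zer_def y algebra_simps)
  then have "\<theta> * (M y \<bullet> M u) \<le> M y \<bullet> (u - z)"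
    by (simp add: inner_diff_right)
  then have cross: "\<theta>\<^sup>2 * (M y \<bullet> M u) \<le> \<theta> * (M y \<bullet> (u - z))"
    using \<theta> by (simp add: power2_eq_square)
  have "norm (M y - M u) \<le> L * norm (y - u)"
    using lipschitz_onD[OF lip, of y u] by (simp add: dist_norm)
  also have "\<dots> = (\<theta> * L) * norm (M u)"
    using \<theta> by (simp add: y)
  finally have "(norm (M y - M u))\<^sup>2 \<le> (\<theta> * L)\<^sup>2 * (norm (M u))\<^sup>2"
    unfolding power_mult_distrib[symmetric] by (rule power_mono) simp
  then have lip_yu: "\<theta>\<^sup>2 * (norm (M y - M u))\<^sup>2 \<le> \<theta>\<^sup>2 * ((\<theta> * L)\<^sup>2 * (norm (M u))\<^sup>2)"
    by (rule mult_left_mono) simp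
  have "(norm (v - z))\<^sup>2 = (norm (u - z - \<theta> *\<^sub>R M y))\<^sup>2"
    by (simp add: v algebra_simps)
  also have "\<dots> = (norm (u - z))\<^sup>2 - 2 * (\<theta> * (M y \<bullet> (u - z))) + \<theta>\<^sup>2 * (norm (M y))\<^sup>2"
    by (simp only: power2_norm_eq_inner)
      (simp add: inner_diff_left inner_diff_right inner_commute power2_eq_square algebra_simps)
  also have "\<dots> \<le> (norm (u - z))\<^sup>2 - 2 * (\<theta>\<^sup>2 * (M y \<bullet> M u)) + \<theta>\<^sup>2 * (norm (M y))\<^sup>2"
    using cross by simp
  also have "\<dots> = (norm (u - z))\<^sup>2 - \<theta>\<^sup>2 * (norm (M u))\<^sup>2 + \<theta>\<^sup>2 * (norm (M y - M u))\<^sup>2"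
    by (simp add: power2_norm_eq_inner inner_diff_left inner_diff_right inner_commute algebra_simps)
  finally show ?thesis
    using lip_yu by (simp add: algebra_simps)
qed

section \<open>The residual along the iteration\<close>

lemma extra_gradient_residual_square_summable:
  fixes M :: "'a::real_inner \<Rightarrow> 'a"
  assumes mono: "monotone_operator M" and lip: "L-lipschitz_on UNIV M"
    and \<theta>: "0 < \<theta>" "\<theta> * L < 1" and zer: "zer M \<noteq> {}"
    and eg: "extra_gradient M \<theta> x y"
  shows "summable (\<lambda>k. (norm (M (x k)))\<^sup>2)"
proof -
  obtain z where z: "z \<in> zer M" using zer by blast
  define C where "C = \<theta>\<^sup>2 * (1 - (\<theta> * L)\<^sup>2)"
  have "0 \<le> \<theta> * L"
    using \<theta>(1) lipschitz_on_nonneg[OF lip] by simp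
  then have "(\<theta> * L)\<^sup>2 < 1"
    using \<theta>(2) by (simp add: power_less_one_iff)
  then have C: "0 < C"
    using \<theta>(1) by (simp add: C_def)
  have step: "(norm (x (Suc k) - z))\<^sup>2 + C * (norm (M (x k)))\<^sup>2 \<le> (norm (x k - z))\<^sup>2" for k
    unfolding C_def
    by (rule extra_gradient_step_distance[OF mono lip \<theta>(1) z, of "y (Suc k)"])
      (use eg in \<open>auto simp: extra_gradient_def\<close>)
  have telescope:
    "(norm (x n - z))\<^sup>2 + (\<Sum>k<n. C * (norm (M (x k)))\<^sup>2) \<le> (norm (x 0 - z))\<^sup>2" for n
  proof (induction n)
    case (Suc n)
    then show ?case using step[of n] by simp
  qed simp
  have "summable (\<lambda>k. C * (norm (M (x k)))\<^sup>2)"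
  proof (rule summableI_nonneg_bounded)
    show "0 \<le> C * (norm (M (x k)))\<^sup>2" for k
      using C by simp
    show "(\<Sum>k<n. C * (norm (M (x k)))\<^sup>2) \<le> (norm (x 0 - z))\<^sup>2" for n
      using telescope[of n] zero_le_power2[of "norm (x n - z)"] by linarith
  qed
  then show ?thesis
    using C by (simp add: summable_cmult_iff)
qed

theorem mainTheorem3:
  fixes M :: "'a::{real_inner, complete_space} \<Rightarrow> 'a"
    and L \<theta> :: real
    and x\<^sub>0 :: 'a
    and x y :: "nat \<Rightarrow> 'a"
  assumes "L > 0"
    and "monotone_operator M"
    and "L-lipschitz_on UNIV M"
    and "zer M \<noteq> {}"
    and "\<theta> > 0"
    and "x 0 = x\<^sub>0"
    and "extra_gradient M \<theta> x y"
  shows "(\<theta> \<in> {0<..1/L} \<longrightarrow> (\<forall>k. norm (M (x (Suc k))) \<le> norm (M (x k)))) \<and>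
         (\<theta> \<in> {0<..<1/L} \<longrightarrow>
            (\<lambda>k. norm (M (x k))) \<in> o[sequentially](\<lambda>k. real k powr (-1/2)))"
proof -
  have decreasing: "norm (M (x (Suc k))) \<le> norm (M (x k))" if "\<theta> * L \<le> 1" for k
    by (rule extra_gradient_step_residual[OF assms(2,3,5) that, of "y (Suc k)"])
      (use assms(7) in \<open>auto simp: extra_gradient_def\<close>)
  have rate: "(\<lambda>k. norm (M (x k))) \<in> o[sequentially](\<lambda>k. real k powr (-1/2))"
    if small: "\<theta> * L < 1"
  proof (rule smalloI_tendsto)
    have "decseq (\<lambda>k. (norm (M (x k)))\<^sup>2)"
      using decreasing small by (intro decseq_SucI power_mono) auto
    then have "(\<lambda>k. real k * (norm (M (x k)))\<^sup>2) \<longlonglongrightarrow> 0"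
      using extra_gradient_residual_square_summable[OF assms(2,3,5) small assms(4,7)]
      by (rule decseq_summable_times_index_tendsto_0) simp
    then have "(\<lambda>k. sqrt (real k * (norm (M (x k)))\<^sup>2)) \<longlonglongrightarrow> 0"
      by (rule tendsto_real_sqrt[where x = 0, simplified])
    then show "(\<lambda>k. norm (M (x k)) / real k powr (-1/2)) \<longlonglongrightarrow> 0"
      by (simp add: real_sqrt_mult powr_minus_divide powr_half_sqrt mult.commute)
    show "\<forall>\<^sub>F k in sequentially. real k powr (-1/2) \<noteq> 0"
      using eventually_gt_at_top[of "0::nat"] by eventually_elim simp
  qed
  have "\<theta> * L \<le> 1" if "\<theta> \<in> {0<..1/L}"
    using that assms(1) by (simp add: pos_le_divide_eq)
  moreover have "\<theta> * L < 1" if "\<theta> \<in> {0<..<1/L}"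
    using that assms(1) by (simp add: pos_less_divide_eq)
  ultimately show ?thesis
    using decreasing rate by blast
qed

end
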